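(* Let $m\in\mathbb{N}$, $(\beta_0,\dots,\beta_m)\in D_m$, $x\in[0,\frac{m}{\beta_m-1}]$, let $w\in\{0,\dots,m\}^{\mathbb{N}}$ be a $(\beta_0,\dots,\beta_m)$-expansion of $x$, and let $$\xi_+:=\max_{0\le k\le m-1}T_k(a_{k+1}),\quad\xi_-:=\min_{0\le k\le m-1}T_k(a_{k+1}),\quad\eta_+:=\max_{1\le k\le m}T_k(b_{k-1}),\quad\eta_-:=\min_{1\le k\le m}T_k(b_{k-1}).$$ Here $n$ ranges over $\mathbb{N}$. (1) (i) If $w$ is the greedy expansion of $x$, then $\sigma^nw\prec g^*(\xi_+)$ whenever $w_n<m$. (ii) If $\sigma^nw\prec g^*(\xi_-)$ whenever $w_n<m$, then $w$ is the greedy expansion of $x$. (2) (i) If $w$ is the lazy expansion of $x$, then $\sigma^nw\succ l^*(\eta_-)$ whenever $w_n>0$. (ii) If $\sigma^nw\succ l^*(\eta_+)$ whenever $w_n>0$, then $w$ is the lazy expansion of $x$. (3) (i) If $w$ is the unique expansion of $x$, then $\sigma^nw\prec g^*(\xi_+)$ whenever $w_n<m$, and $\sigma^nw\succ l^*(\eta_-)$ whenever $w_n>0$. (ii) If $\sigma^nw\prec g^*(\xi_-)$ whenever $w_n<m$, and $\sigma^nw\succ l^*(\eta_+)$ whenever $w_n>0$, then $w$ is the unique expansion of $x$.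
   Context: $\mathbb{N}=\{1,2,3,\dots\}$. For $m\in\mathbb{N}$ and real $\beta_0,\dots,\beta_m>1$ put $a_k:=\frac{k}{\beta_k}$, $b_k:=\frac{k}{\beta_k}+\frac{m}{\beta_k(\beta_m-1)}$ and $T_k(x):=\beta_kx-k$ ($x\in\mathbb{R}$) for $k\in\{0,\dots,m\}$; so $a_0=0$, $b_m=\frac{m}{\beta_m-1}$. Define $D_m:=\{(\beta_0,\dots,\beta_m):\beta_0,\dots,\beta_m>1\text{ and }a_k<a_{k+1}\le b_k<b_{k+1}\text{ for all }0\le k\le m-1\}$. A sequence $w\in\{0,\dots,m\}^{\mathbb{N}}$ is a $(\beta_0,\dots,\beta_m)$-expansion of $x\in\mathbb{R}$ if $x=\sum_{i=1}^\infty\frac{w_i}{\beta_{w_1}\cdots\beta_{w_i}}$. It is the unique expansion of $x$ if it is the only $(\beta_0,\dots,\beta_m)$-expansion of $x$. The shift is $\sigma(w_1w_2\cdots)=w_2w_3\cdots$, and $\prec,\preceq,\succ,\succeq$ denote lexicographic order. Let $(\beta_0,\dots,\beta_m)\in D_m$. Define self-maps of $[0,\frac{m}{\beta_m-1}]$ by applying $T_k$ on the $k$-th piece of the following partitions of $[0,\frac{m}{\beta_m-1}]$ ($k=0,\dots,m$): - greedy $G$: pieces $[a_k,a_{k+1})$ for $0\le k\le m-1$, and $[a_m,b_m]$ for $k=m$; - quasi-greedy $G^*$: pieces $[0,a_1]$ for $k=0$, $(a_k,a_{k+1}]$ for $1\le k\le m-1$, and $(a_m,b_m]$ for $k=m$;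 - lazy $L$: pieces $[0,b_0]$ for $k=0$, and $(b_{k-1},b_k]$ for $1\le k\le m$; - quasi-lazy $L^*$: pieces $[0,b_0)$ for $k=0$, $[b_{k-1},b_k)$ for $1\le k\le m-1$, and $[b_{m-1},b_m]$ for $k=m$. For $x\in[0,\frac{m}{\beta_m-1}]$ the greedy expansion $g(x)=(g_n(x))_{n\ge1}$ has $g_n(x)=k$ where $G^{n-1}x$ lies in the $k$-th piece for $G$; the quasi-greedy expansion $g^*(x)$, lazy expansion $l(x)$ and quasi-lazy expansion $l^*(x)$ are defined in the same way from $G^*$, $L$, $L^*$ and their pieces. *)

theory Defs
  imports Complex_Main "HOL-Library.Fun_Lexorder"
begin

text \<open>
  A tuple of bases is a function \<open>\<beta> :: nat \<Rightarrow> real\<close> of which only the values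
  \<open>\<beta> 0, \<dots>, \<beta> m\<close> are used. A sequence \<open>w\<^sub>1 w\<^sub>2 \<dots>\<close> is a function \<open>w :: nat \<Rightarrow> nat\<close>
  indexed from 0, so that \<open>w\<^sub>n\<close> is \<open>w (n - 1)\<close> for \<open>n \<ge> 1\<close>. The strict lexicographic
  order on sequences is \<^const>\<open>less_fun\<close>.
\<close>

definition a_pt :: "(nat \<Rightarrow> real) \<Rightarrow> nat \<Rightarrow> real" where
  "a_pt \<beta> k = real k / \<beta> k"

definition b_pt :: "nat \<Rightarrow> (nat \<Rightarrow> real) \<Rightarrow> nat \<Rightarrow> real" where
  "b_pt m \<beta> k = real k / \<beta> k + real m / (\<beta> k * (\<beta> m - 1))"

definition T_map :: "(nat \<Rightarrow> real) \<Rightarrow> nat \<Rightarrow> real \<Rightarrow> real" where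
  "T_map \<beta> k x = \<beta> k * x - real k"

definition D_set :: "nat \<Rightarrow> (nat \<Rightarrow> real) set" where
  "D_set m = {\<beta>. (\<forall>k\<le>m. \<beta> k > 1) \<and>
     (\<forall>k<m. a_pt \<beta> k < a_pt \<beta> (k + 1) \<and> a_pt \<beta> (k + 1) \<le> b_pt m \<beta> k \<and>
            b_pt m \<beta> k < b_pt m \<beta> (k + 1))}"

definition is_expansion :: "nat \<Rightarrow> (nat \<Rightarrow> real) \<Rightarrow> (nat \<Rightarrow> nat) \<Rightarrow> real \<Rightarrow> bool" where
  "is_expansion m \<beta> w x \<longleftrightarrow>
     (\<forall>i. w i \<le> m) \<and> (\<lambda>i. real (w i) / (\<Prod>j\<le>i. \<beta> (w j))) sums x"

definition is_unique_expansion :: "nat \<Rightarrow> (nat \<Rightarrow> real) \<Rightarrow> (nat \<Rightarrow> nat) \<Rightarrow> real \<Rightarrow> bool" where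
  "is_unique_expansion m \<beta> w x \<longleftrightarrow>
     is_expansion m \<beta> w x \<and> (\<forall>v. is_expansion m \<beta> v x \<longrightarrow> v = w)"

definition seq_shift :: "(nat \<Rightarrow> nat) \<Rightarrow> nat \<Rightarrow> nat" where
  "seq_shift w = (\<lambda>i. w (Suc i))"

definition greedy_piece :: "nat \<Rightarrow> (nat \<Rightarrow> real) \<Rightarrow> nat \<Rightarrow> real set" where
  "greedy_piece m \<beta> k =
     (if k < m then {a_pt \<beta> k..<a_pt \<beta> (k + 1)} else {a_pt \<beta> m..b_pt m \<beta> m})"

definition quasi_greedy_piece :: "nat \<Rightarrow> (nat \<Rightarrow> real) \<Rightarrow> nat \<Rightarrow> real set" where
  "quasi_greedy_piece m \<beta> k =
     (if k = 0 then {0..a_pt \<beta> 1}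
      else if k < m then {a_pt \<beta> k<..a_pt \<beta> (k + 1)}
      else {a_pt \<beta> m<..b_pt m \<beta> m})"

definition lazy_piece :: "nat \<Rightarrow> (nat \<Rightarrow> real) \<Rightarrow> nat \<Rightarrow> real set" where
  "lazy_piece m \<beta> k =
     (if k = 0 then {0..b_pt m \<beta> 0} else {b_pt m \<beta> (k - 1)<..b_pt m \<beta> k})"

definition quasi_lazy_piece :: "nat \<Rightarrow> (nat \<Rightarrow> real) \<Rightarrow> nat \<Rightarrow> real set" where
  "quasi_lazy_piece m \<beta> k =
     (if k = 0 then {0..<b_pt m \<beta> 0}
      else if k < m then {b_pt m \<beta> (k - 1)..<b_pt m \<beta> k}
      else {b_pt m \<beta> (m - 1)..b_pt m \<beta> m})"

text \<open>
  For \<open>m \<ge> 1\<close> and \<open>\<beta> \<in> D_set m\<close>, each of the four families of pieces, with index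
  \<open>k \<le> m\<close>, partitions \<open>{0..m / (\<beta> m - 1)}\<close>, so the digit below is well defined for
  every point of that interval; nothing is claimed about points outside it.
\<close>

definition piece_digit :: "nat \<Rightarrow> (nat \<Rightarrow> real set) \<Rightarrow> real \<Rightarrow> nat" where
  "piece_digit m P x = (THE k. k \<le> m \<and> x \<in> P k)"

definition piece_map :: "nat \<Rightarrow> (nat \<Rightarrow> real) \<Rightarrow> (nat \<Rightarrow> real set) \<Rightarrow> real \<Rightarrow> real" where
  "piece_map m \<beta> P x = T_map \<beta> (piece_digit m P x) x"

definition piece_expansion ::
  "nat \<Rightarrow> (nat \<Rightarrow> real) \<Rightarrow> (nat \<Rightarrow> real set) \<Rightarrow> real \<Rightarrow> nat \<Rightarrow> nat" where
  "piece_expansion m \<beta> P x n = piece_digit m P ((piece_map m \<beta> P ^^ n) x)"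

definition greedy_exp :: "nat \<Rightarrow> (nat \<Rightarrow> real) \<Rightarrow> real \<Rightarrow> nat \<Rightarrow> nat" where
  "greedy_exp m \<beta> = piece_expansion m \<beta> (greedy_piece m \<beta>)"

definition quasi_greedy_exp :: "nat \<Rightarrow> (nat \<Rightarrow> real) \<Rightarrow> real \<Rightarrow> nat \<Rightarrow> nat" where
  "quasi_greedy_exp m \<beta> = piece_expansion m \<beta> (quasi_greedy_piece m \<beta>)"

definition lazy_exp :: "nat \<Rightarrow> (nat \<Rightarrow> real) \<Rightarrow> real \<Rightarrow> nat \<Rightarrow> nat" where
  "lazy_exp m \<beta> = piece_expansion m \<beta> (lazy_piece m \<beta>)"

definition quasi_lazy_exp :: "nat \<Rightarrow> (nat \<Rightarrow> real) \<Rightarrow> real \<Rightarrow> nat \<Rightarrow> nat" where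
  "quasi_lazy_exp m \<beta> = piece_expansion m \<beta> (quasi_lazy_piece m \<beta>)"

definition xi_plus :: "nat \<Rightarrow> (nat \<Rightarrow> real) \<Rightarrow> real" where
  "xi_plus m \<beta> = (MAX k\<in>{0..m - 1}. T_map \<beta> k (a_pt \<beta> (k + 1)))"

definition xi_minus :: "nat \<Rightarrow> (nat \<Rightarrow> real) \<Rightarrow> real" where
  "xi_minus m \<beta> = (MIN k\<in>{0..m - 1}. T_map \<beta> k (a_pt \<beta> (k + 1)))"

definition eta_plus :: "nat \<Rightarrow> (nat \<Rightarrow> real) \<Rightarrow> real" where
  "eta_plus m \<beta> = (MAX k\<in>{1..m}. T_map \<beta> k (b_pt m \<beta> (k - 1)))"

definition eta_minus :: "nat \<Rightarrow> (nat \<Rightarrow> real) \<Rightarrow> real" where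
  "eta_minus m \<beta> = (MIN k\<in>{1..m}. T_map \<beta> k (b_pt m \<beta> (k - 1)))"

end

theory Submission
  imports Defs
begin

text \<open>
  An expansion \<open>w\<close> of \<open>x\<close> is the same thing as an orbit \<open>X\<close> that starts at \<open>x\<close>, stays in
  \<open>[0, m / (\<beta> m - 1)]\<close> and moves by \<open>X (n + 1) = T\<^sub>k (X n)\<close> with \<open>k = w n\<close> (\<open>orbit_of_expansion\<close>,
  \<open>expansion_of_orbit\<close>). Staying in the interval already forces \<open>a\<^sub>k \<le> X n \<le> b\<^sub>k\<close>. Hence \<open>w\<close> is
  greedy iff \<open>X n < a\<^bsub>k+1\<^esub>\<close> whenever \<open>k < m\<close>, and after one application of \<open>T\<^sub>k\<close> this reads
  \<open>X (n + 1) < T\<^sub>k (a\<^bsub>k+1\<^esub>)\<close> (\<open>greedy_exp_iff\<close>). The numbers \<open>\<xi>\<^sub>+\<close> and \<open>\<xi>\<^sub>-\<close> are the extreme values of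
  the right-hand side, so \<open>X (n + 1) < \<xi>\<^sub>+\<close> is necessary and \<open>X (n + 1) < \<xi>\<^sub>-\<close> is sufficient.

  It remains to translate inequalities between points into inequalities between sequences. A
  common prefix of two orbits multiplies their distance by a factor that grows exponentially with
  its length. This yields both directions: a point below \<open>\<xi>\<close> has only expansions below the
  quasi-greedy expansion of \<open>\<xi>\<close> (\<open>less_quasi_greedy_if_less\<close>); and if the tails of \<open>w\<close> after digits
  less than \<open>m\<close> are all lexicographically below the quasi-greedy expansion of \<open>\<xi>\<^sub>-\<close>, then these
  tails represent points below \<open>\<xi>\<^sub>-\<close>, by a contraction argument in the style of Parry
  (\<open>parry_criterion\<close>).

  The statements on lazy expansions are the same two lemmas after the reflection \<open>x \<mapsto> -x\<close>,
  \<open>k \<mapsto> m - k\<close>; this is why the lemmas are proved for branches \<open>x \<mapsto> lo + \<beta> k * (x - a k)\<close> with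
  free left ends \<open>a k\<close>. The statements on unique expansions follow since an expansion is unique iff
  it is both greedy and lazy (\<open>unique_iff_greedy_and_lazy\<close>).
\<close>

section \<open>Expanding affine branches\<close>

text \<open>
  Only left ends are parameters: everything about right ends is obtained from a second instance,
  the reflected branches.
\<close>

locale expanding_branches =
  fixes m :: nat and \<beta> a :: "nat \<Rightarrow> real" and lo hi :: real
  assumes expanding: "k \<le> m \<Longrightarrow> \<beta> k > 1"
    and left_ends_increase: "k < m \<Longrightarrow> a k < a (Suc k)"
begin

definition branch :: "nat \<Rightarrow> real \<Rightarrow> real" where
  "branch k x = lo + \<beta> k * (x - a k)"

definition orbit :: "(nat \<Rightarrow> nat) \<Rightarrow> (nat \<Rightarrow> real) \<Rightarrow> bool" where
  "orbit w X \<longleftrightarrow> (\<forall>n. w n \<le> m \<and> X n \<in> {lo..hi} \<and> X (Suc n) = branch (w n) (X n))"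

lemma orbit_digit_le: "orbit w X \<Longrightarrow> w n \<le> m"
  by (simp add: orbit_def)

lemma orbit_bounds: "orbit w X \<Longrightarrow> lo \<le> X n" "orbit w X \<Longrightarrow> X n \<le> hi"
  by (simp_all add: orbit_def)

lemma orbit_Suc: "orbit w X \<Longrightarrow> X (Suc n) = branch (w n) (X n)"
  by (simp add: orbit_def)

lemma orbit_shift: "orbit w X \<Longrightarrow> orbit (\<lambda>i. w (i + n)) (\<lambda>i. X (i + n))"
  by (simp add: orbit_def)

lemma branch_diff: "branch k x - branch k y = \<beta> k * (x - y)"
  by (simp add: branch_def algebra_simps)

lemma branch_less_iff: "k \<le> m \<Longrightarrow> branch k x < branch k y \<longleftrightarrow> x < y"
  using expanding[of k] by (simp add: branch_def)

lemma left_ends_mono: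
  assumes "j \<le> k" "k \<le> m"
  shows "a j \<le> a k"
  using assms
proof (induction k rule: dec_induct)
  case (step i)
  then show ?case using left_ends_increase[of i] by simp
qed simp

text \<open>
  To the left of \<open>a k\<close> the branch \<open>k\<close> takes values below \<open>lo\<close>, and the orbit would leave the interval.
\<close>

lemma orbit_left_end_le:
  assumes "orbit w X"
  shows "a (w n) \<le> X n"
proof (rule ccontr)
  assume "\<not> a (w n) \<le> X n"
  moreover have "w n \<le> m" using assms by (rule orbit_digit_le)
  ultimately have "branch (w n) (X n) < branch (w n) (a (w n))"
    by (simp add: branch_less_iff)
  also have "branch (w n) (a (w n)) = lo" by (simp add: branch_def)
  finally show False
    using orbit_bounds(1)[OF assms, of "Suc n"] orbit_Suc[OF assms, of n] by simp
qed

lemma uniform_expansion: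
  obtains q where "q > 1" "\<And>k. k \<le> m \<Longrightarrow> q \<le> \<beta> k"
proof
  show "Min (\<beta> ` {..m}) > 1" using expanding by (subst Min_gr_iff) auto
  show "\<And>k. k \<le> m \<Longrightarrow> Min (\<beta> ` {..m}) \<le> \<beta> k" by (simp add: Min_le)
qed

lemma common_prefix_expands:
  assumes "orbit w X" "orbit v Y" "\<And>i. i < n \<Longrightarrow> w i = v i"
    and q: "q \<ge> 0" "\<And>k. k \<le> m \<Longrightarrow> q \<le> \<beta> k"
  obtains P where "P \<ge> q ^ n" "Y n - X n = P * (Y 0 - X 0)"
proof -
  have "\<exists>P\<ge>q ^ n. Y n - X n = P * (Y 0 - X 0)"
    using assms(3)
  proof (induction n)
    case 0
    show ?case by (intro exI[of _ 1]) simp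
  next
    case (Suc n)
    then obtain P where P: "P \<ge> q ^ n" "Y n - X n = P * (Y 0 - X 0)" by auto
    have "Y (Suc n) - X (Suc n) = \<beta> (w n) * (Y n - X n)"
      using Suc.prems[of n] assms(1,2) by (simp add: orbit_Suc branch_diff)
    moreover have "q * q ^ n \<le> \<beta> (w n) * P"
      using P(1) q orbit_digit_le[OF assms(1), of n]
      by (intro mult_mono) (auto intro: order_trans)
    ultimately show ?case
      using P(2) by (intro exI[of _ "\<beta> (w n) * P"]) simp
  qed
  then show thesis using that by blast
qed

text \<open>
  A common prefix expands distances while all orbits stay in one bounded interval, so two
  orbits with the same digits start at the same point.
\<close>

lemma orbit_start_unique:
  assumes "orbit w X" "orbit w Y"
  shows "X 0 = Y 0"
proof (rule ccontr)
  assume "X 0 \<noteq> Y 0"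
  then have pos: "\<bar>Y 0 - X 0\<bar> > 0" by simp
  obtain q where q: "q > 1" "\<And>k. k \<le> m \<Longrightarrow> q \<le> \<beta> k" using uniform_expansion by blast
  obtain n where n: "(hi - lo) / \<bar>Y 0 - X 0\<bar> < q ^ n"
    using real_arch_pow[OF q(1)] by blast
  obtain P where P: "P \<ge> q ^ n" "Y n - X n = P * (Y 0 - X 0)"
    using common_prefix_expands[OF assms, of n q] q by auto
  have "hi - lo < q ^ n * \<bar>Y 0 - X 0\<bar>"
    using n pos by (simp add: pos_divide_less_eq)
  also have "\<dots> \<le> P * \<bar>Y 0 - X 0\<bar>" using P(1) by (intro mult_right_mono) auto
  also have "\<dots> \<le> \<bar>Y n - X n\<bar>" using P(2) by (simp add: abs_mult mult_right_mono)
  finally show False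
    using orbit_bounds[OF assms(1), of n] orbit_bounds[OF assms(2), of n] by linarith
qed

text \<open>
  Along the common prefix the order of the two points is preserved. At the first difference a
  larger digit of \<open>w\<close> would put its point to the right of the left end that bounds the point
  of the quasi-greedy \<open>v\<close>.
\<close>

lemma less_quasi_greedy_if_less:
  assumes X: "orbit w X" and Y: "orbit v Y"
    and quasi_greedy: "\<And>n. v n < m \<Longrightarrow> Y n \<le> a (Suc (v n))"
    and less: "X 0 < Y 0"
  shows "less_fun w v"
proof -
  obtain q where q: "q > 1" "\<And>k. k \<le> m \<Longrightarrow> q \<le> \<beta> k" using uniform_expansion by blast
  have "w \<noteq> v" using orbit_start_unique[of w X Y] X Y less by auto
  then have ex: "\<exists>n. w n \<noteq> v n" by auto
  define n where "n = (LEAST n. w n \<noteq> v n)"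
  have ne: "w n \<noteq> v n" unfolding n_def using ex by (rule LeastI_ex)
  have eq: "w i = v i" if "i < n" for i using that not_less_Least unfolding n_def by blast
  obtain P where P: "P \<ge> q ^ n" "Y n - X n = P * (Y 0 - X 0)"
    using common_prefix_expands[OF X Y eq, of n q] q by auto
  have "0 < q ^ n" using q(1) by simp
  with P(1) have "P > 0" by linarith
  with P(2) less have "X n < Y n" by (metis diff_gt_0_iff_gt mult_pos_pos)
  moreover have "Y n \<le> X n" if "v n < w n"
  proof -
    have "Y n \<le> a (Suc (v n))"
      using that orbit_digit_le[OF X, of n] by (intro quasi_greedy) simp
    also have "\<dots> \<le> a (w n)"
      using that orbit_digit_le[OF X, of n] by (intro left_ends_mono) simp_all
    also have "\<dots> \<le> X n" using X by (rule orbit_left_end_le)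
    finally show ?thesis .
  qed
  ultimately have "w n < v n" using ne by force
  with eq show ?thesis by (auto simp: less_fun_def)
qed

text \<open>
  A digit beyond the greedy digit \<open>k\<close> has its left end to the right of the point.
\<close>

lemma digit_le_greedy_digit:
  assumes "orbit v Y" "v n \<le> m" "k < m \<Longrightarrow> Y n < a (Suc k)"
  shows "v n \<le> k"
proof (rule ccontr)
  assume "\<not> v n \<le> k"
  then have "a (Suc k) \<le> a (v n)" "k < m"
    using assms(2) by (auto intro!: left_ends_mono)
  with assms orbit_left_end_le[OF assms(1), of n] show False by force
qed

text \<open>
  An excess \<open>X (Suc n) - Y 0\<close> depends on a later excess of the same kind, and this circularity is
  broken by contraction. Let \<open>D \<ge> 0\<close> bound all excesses with \<open>w n < m\<close>. Where the tail of \<open>w\<close> first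
  falls below \<open>v\<close>, it has a digit \<open>k < m\<close>, and the point of \<open>v\<close> is to the right of \<open>a (Suc k)\<close>. One
  step later the excess is at most \<open>D\<close>, and the image of \<open>a (Suc k)\<close> is at least \<open>Y 0\<close>; so the
  point of \<open>w\<close> exceeds that of \<open>v\<close> by less than \<open>D / q\<close>, where \<open>q > 1\<close> bounds all bases from
  below. Pulling a positive distance back along the common prefix does not increase it. Hence all
  excesses are below \<open>D / q\<close>; by iteration they are at most \<open>0\<close>, and then negative.
\<close>

lemma parry_criterion:
  assumes X: "orbit w X" and Y: "orbit v Y"
    and quasi_greedy: "\<And>n. v n > 0 \<Longrightarrow> a (v n) < Y n"
    and start: "\<And>k. k < m \<Longrightarrow> Y 0 \<le> branch k (a (Suc k))"
    and lex: "\<And>n. w n < m \<Longrightarrow> less_fun (\<lambda>i. w (i + Suc n)) v"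
    and n: "w n < m"
  shows "X (Suc n) < Y 0"
proof -
  obtain q where q: "q > 1" "\<And>k. k \<le> m \<Longrightarrow> q \<le> \<beta> k" using uniform_expansion by blast
  have contract: "X (Suc n) - Y 0 < D / q"
    if D: "D \<ge> 0" "\<And>n. w n < m \<Longrightarrow> X (Suc n) - Y 0 \<le> D" and n: "w n < m" for D n
  proof -
    obtain i where i: "w (i + Suc n) < v i" "\<And>j. j < i \<Longrightarrow> w (j + Suc n) = v j"
      using lex[OF n] by (auto simp: less_fun_def)
    define k where "k = w (i + Suc n)"
    have k: "k < m" "Suc k \<le> v i"
      using i(1) orbit_digit_le[OF Y, of i] by (simp_all add: k_def)
    note shifted = orbit_shift[OF X, of "Suc n"]
    obtain P where P: "P \<ge> q ^ i" "X (i + Suc n) - Y i = P * (X (Suc n) - Y 0)"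
      using common_prefix_expands[OF Y shifted, of i q] i(2) q by auto
    have "1 \<le> q ^ i" using q(1) by (simp add: one_le_power)
    with P(1) have "P \<ge> 1" by linarith
    have "a (Suc k) \<le> a (v i)"
      using k orbit_digit_le[OF Y, of i] by (intro left_ends_mono) auto
    also have "\<dots> < Y i" using i(1) by (intro quasi_greedy) simp
    finally have "X (i + Suc n) - Y i < X (i + Suc n) - a (Suc k)" by simp
    also have "\<dots> \<le> D / \<beta> k"
    proof -
      have "\<beta> k * (X (i + Suc n) - a (Suc k)) = X (Suc (i + Suc n)) - branch k (a (Suc k))"
        using orbit_Suc[OF X, of "i + Suc n"] by (simp add: k_def branch_diff)
      also have "\<dots> \<le> D" using D(2)[of "i + Suc n"] start[OF k(1)] k(1) by (simp add: k_def)
      finally show ?thesis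
        using expanding[of k] k(1) by (simp add: pos_le_divide_eq mult.commute)
    qed
    also have "\<dots> \<le> D / q" using q k(1) D(1) by (intro frac_le) auto
    finally have less: "P * (X (Suc n) - Y 0) < D / q" using P(2) by simp
    show ?thesis
    proof (rule ccontr)
      assume "\<not> ?thesis"
      moreover have "0 \<le> D / q" using D(1) q(1) by simp
      ultimately have "X (Suc n) - Y 0 \<le> P * (X (Suc n) - Y 0)"
        using mult_right_mono[OF \<open>P \<ge> 1\<close>, of "X (Suc n) - Y 0"] by simp
      from le_less_trans[OF this less] \<open>\<not> ?thesis\<close> show False by contradiction
    qed
  qed
  \<comment> \<open>The length of the interval is a first bound for all excesses.\<close>
  have le: "X (Suc n) - Y 0 \<le> (hi - lo) / q ^ j" if "w n < m" for n j
    using that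
  proof (induction j arbitrary: n)
    case 0
    then show ?case using orbit_bounds[OF X, of "Suc n"] orbit_bounds[OF Y, of 0] by simp
  next
    case (Suc j)
    have "0 \<le> (hi - lo) / q ^ j" using q(1) orbit_bounds[OF Y, of 0] by simp
    from contract[OF this Suc.IH Suc.prems] show ?case by (simp add: field_simps)
  qed
  have "(\<lambda>j. (hi - lo) / q ^ j) \<longlonglongrightarrow> 0"
    using q(1) by (rule LIMSEQ_divide_realpow_zero)
  then have "X (Suc n) - Y 0 \<le> 0" if "w n < m" for n
    using le[OF that] by (intro LIMSEQ_le_const) auto
  \<comment> \<open>The limit only gives a weak inequality; one more contraction makes it strict.\<close>
  from contract[of 0, OF _ this n] show ?thesis by simp
qed

end

section \<open>Expansions and digit partitions\<close>

text \<open>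
  Applied to the property that \<open>x\<close> lies in or to the left of the \<open>k\<close>-th piece, this shows that
  each of the four families of intervals is a partition.
\<close>

lemma ex1_threshold:
  fixes Q :: "nat \<Rightarrow> bool"
  assumes "Q m" and mono: "\<And>j k. j \<le> k \<Longrightarrow> k \<le> m \<Longrightarrow> Q j \<Longrightarrow> Q k"
  shows "\<exists>!k. k \<le> m \<and> Q k \<and> (k = 0 \<or> \<not> Q (k - 1))"
proof
  let ?k = "LEAST k. Q k"
  show "?k \<le> m \<and> Q ?k \<and> (?k = 0 \<or> \<not> Q (?k - 1))"
    using LeastI[of Q, OF \<open>Q m\<close>] Least_le[of Q, OF \<open>Q m\<close>] not_less_Least[of "?k - 1" Q] by auto
next
  fix k assume k: "k \<le> m \<and> Q k \<and> (k = 0 \<or> \<not> Q (k - 1))"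
  have "k \<le> j" if "Q j" for j
  proof (rule ccontr)
    assume "\<not> k \<le> j"
    then have "j \<le> k - 1" "k - 1 \<le> m" "k \<noteq> 0" using k by linarith+
    with mono[OF _ _ that] k show False by blast
  qed
  with k show "k = (LEAST k. Q k)" by (metis Least_equality)
qed

locale multiple_bases =
  fixes m :: nat and \<beta> :: "nat \<Rightarrow> real"
  assumes m_pos: "m \<ge> 1" and bases: "\<beta> \<in> D_set m"
begin

abbreviation top :: real where
  "top \<equiv> real m / (\<beta> m - 1)"

lemma base_gt_1: "k \<le> m \<Longrightarrow> \<beta> k > 1"
  using bases by (simp add: D_set_def)

lemma a_less: "k < m \<Longrightarrow> a_pt \<beta> k < a_pt \<beta> (Suc k)"
  and a_le_b: "k < m \<Longrightarrow> a_pt \<beta> (Suc k) \<le> b_pt m \<beta> k"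
  and b_less: "k < m \<Longrightarrow> b_pt m \<beta> k < b_pt m \<beta> (Suc k)"
  using bases by (simp_all add: D_set_def)

text \<open>
  The reflection \<open>x \<mapsto> -x\<close>, \<open>k \<mapsto> m - k\<close> turns right ends into left ends and lazy choices into
  greedy ones. The reflected maps are in general not of the form \<open>x \<mapsto> \<beta> k * x - k\<close>, but they
  are expanding affine branches; thus every result on the lazy side is the result on the greedy
  side for the reflected branches.
\<close>

sublocale greedy: expanding_branches m \<beta> "a_pt \<beta>" 0 top
  by unfold_locales (simp_all add: base_gt_1 a_less)

sublocale lazy: expanding_branches m "\<lambda>k. \<beta> (m - k)" "\<lambda>k. - b_pt m \<beta> (m - k)" "- top" 0
proof
  fix k assume "k < m"
  then show "- b_pt m \<beta> (m - k) < - b_pt m \<beta> (m - Suc k)"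
    using b_less[of "m - Suc k"] by (simp add: Suc_diff_Suc)
qed (simp add: base_gt_1)

lemma greedy_branch: "k \<le> m \<Longrightarrow> greedy.branch k x = T_map \<beta> k x"
  using base_gt_1[of k] by (simp add: greedy.branch_def T_map_def a_pt_def right_diff_distrib)

lemma T_map_less_iff: "k \<le> m \<Longrightarrow> T_map \<beta> k x < T_map \<beta> k y \<longleftrightarrow> x < y"
  using base_gt_1[of k] by (simp add: T_map_def)

lemma T_map_le_iff: "k \<le> m \<Longrightarrow> T_map \<beta> k x \<le> T_map \<beta> k y \<longleftrightarrow> x \<le> y"
  using base_gt_1[of k] by (simp add: T_map_def)

lemma T_map_ends:
  assumes "k \<le> m"
  shows "T_map \<beta> k (a_pt \<beta> k) = 0" "T_map \<beta> k (b_pt m \<beta> k) = top"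
  using base_gt_1[OF assms] by (simp_all add: T_map_def a_pt_def b_pt_def distrib_left)

lemma lazy_branch:
  "lazy.branch k (- x) = - T_map \<beta> (m - k) x"
  using T_map_ends(2)[of "m - k"] by (simp add: lazy.branch_def T_map_def right_diff_distrib)

lemma a_0: "a_pt \<beta> 0 = 0"
  by (simp add: a_pt_def)

lemma b_top: "b_pt m \<beta> m = top"
  using base_gt_1[of m] by (simp add: b_pt_def field_simps)

lemma top_nonneg: "0 \<le> top"
  using base_gt_1[of m] by simp

lemma b_mono: "j \<le> k \<Longrightarrow> k \<le> m \<Longrightarrow> b_pt m \<beta> j \<le> b_pt m \<beta> k"
  using lazy.left_ends_mono[of "m - k" "m - j"] by simp

abbreviation orbit :: "(nat \<Rightarrow> nat) \<Rightarrow> (nat \<Rightarrow> real) \<Rightarrow> bool" where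
  "orbit \<equiv> greedy.orbit"

lemma orbit_iff:
  "orbit w X \<longleftrightarrow> (\<forall>n. w n \<le> m \<and> X n \<in> {0..top} \<and> X (Suc n) = T_map \<beta> (w n) (X n))"
  unfolding greedy.orbit_def by (metis greedy_branch)

lemma orbit_reflect:
  assumes "orbit w X"
  shows "lazy.orbit (\<lambda>n. m - w n) (\<lambda>n. - X n)"
  using assms by (simp add: orbit_iff lazy.orbit_def lazy_branch)

lemma less_fun_reflect:
  assumes "less_fun (\<lambda>n. m - w n) (\<lambda>n. m - v n)" "\<And>n. w n \<le> m" "\<And>n. v n \<le> m"
  shows "less_fun v w"
proof -
  obtain k where k: "m - w k < m - v k" "\<And>j. j < k \<Longrightarrow> m - w j = m - v j"
    using assms(1) by (auto simp: less_fun_def)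
  then have "v k < w k" by linarith
  moreover have "v j = w j" if "j < k" for j
    using k(2)[OF that] assms(2,3)[of j] by linarith
  ultimately show ?thesis by (auto simp: less_fun_def)
qed

lemma less_fun_reflectI:
  assumes "less_fun v w" "\<And>n. w n \<le> m" "\<And>n. v n \<le> m"
  shows "less_fun (\<lambda>n. m - w n) (\<lambda>n. m - v n)"
proof -
  obtain k where "v k < w k" "\<And>j. j < k \<Longrightarrow> v j = w j"
    using assms(1) by (auto simp: less_fun_def)
  with assms(2)[of k] show ?thesis by (auto simp: less_fun_def intro!: exI[of _ k] diff_less_mono2)
qed

abbreviation weight :: "(nat \<Rightarrow> nat) \<Rightarrow> nat \<Rightarrow> real" where
  "weight w i \<equiv> real (w i) / (\<Prod>j\<le>i. \<beta> (w j))"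

lemma weight_Suc: "weight w (Suc i) = weight (\<lambda>i. w (Suc i)) i / \<beta> (w 0)"
  by (simp add: prod.atMost_Suc_shift del: prod.atMost_Suc)

text \<open>
  A partial sum followed by zeros has the form \<open>(k + s) / \<beta> k\<close> with \<open>s\<close> a shorter partial sum,
  and \<open>s \<le> top\<close> gives \<open>(k + s) / \<beta> k \<le> b\<^sub>k \<le> b\<^sub>m = top\<close>.
\<close>

lemma partial_sum_le_top:
  assumes "\<And>i. w i \<le> m"
  shows "(\<Sum>i<n. weight w i) \<le> top"
  using assms
proof (induction n arbitrary: w)
  case 0
  show ?case using top_nonneg by simp
next
  case (Suc n)
  have "(\<Sum>i<Suc n. weight w i) = (real (w 0) + (\<Sum>i<n. weight (\<lambda>i. w (Suc i)) i)) / \<beta> (w 0)"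
    by (simp only: sum.lessThan_Suc_shift weight_Suc add_divide_distrib sum_divide_distrib) simp
  also have "\<dots> \<le> (real (w 0) + top) / \<beta> (w 0)"
    using Suc base_gt_1[of "w 0"] by (intro divide_right_mono add_left_mono) (auto simp: less_imp_le)
  also have "\<dots> = b_pt m \<beta> (w 0)"
    using base_gt_1[of m] by (simp add: b_pt_def add_divide_distrib mult.commute)
  also have "\<dots> \<le> top" using b_mono[of "w 0" m] Suc.prems b_top by simp
  finally show ?case .
qed

lemma is_expansion_bounds:
  assumes "is_expansion m \<beta> w x"
  shows "0 \<le> x" "x \<le> top"
proof -
  have w: "w i \<le> m" and sums: "weight w sums x" for i
    using assms by (auto simp: is_expansion_def)
  have "0 \<le> weight w i" for i
    using w base_gt_1 by (intro divide_nonneg_nonneg prod_nonneg)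
      (auto simp: less_imp_le order.strict_trans[OF zero_less_one])
  then show "0 \<le> x" using sums sums_le[OF _ sums_zero sums] by blast
  show "x \<le> top"
    using sums partial_sum_le_top[OF w] unfolding sums_def by (intro LIMSEQ_le_const2) auto
qed

lemma is_expansion_shift:
  assumes "is_expansion m \<beta> w x"
  shows "is_expansion m \<beta> (\<lambda>i. w (Suc i)) (T_map \<beta> (w 0) x)"
proof -
  have b: "\<beta> (w 0) > 1" and w: "\<And>i. w i \<le> m" and sums: "weight w sums x"
    using assms base_gt_1 by (auto simp: is_expansion_def)
  have "(\<lambda>i. weight w (Suc i)) sums (x - weight w 0)"
    using sums by (subst sums_Suc_iff) simp
  from sums_mult[OF this[unfolded weight_Suc], of "\<beta> (w 0)"] b
  have "weight (\<lambda>i. w (Suc i)) sums T_map \<beta> (w 0) x"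
    by (simp add: T_map_def right_diff_distrib)
  with w show ?thesis by (simp add: is_expansion_def)
qed

text \<open>
  The points of the orbit are the values of the tails of the series.
\<close>

lemma orbit_of_expansion:
  assumes "is_expansion m \<beta> w x"
  obtains X where "orbit w X" "X 0 = x"
proof
  define X where "X = rec_nat x (\<lambda>n. T_map \<beta> (w n))"
  show "X 0 = x" by (simp add: X_def)
  have "is_expansion m \<beta> (\<lambda>i. w (i + n)) (X n)" for n
  proof (induction n)
    case 0
    show ?case using assms by (simp add: X_def)
  next
    case (Suc n)
    from is_expansion_shift[OF this] show ?case by (simp add: X_def)
  qed
  from is_expansion_bounds[OF this] show "orbit w X"
    using assms unfolding orbit_iff is_expansion_def by (simp add: X_def)
qed

text \<open>
  After \<open>n\<close> digits the remainder of the series is \<open>X n\<close> divided by a product of \<open>n\<close> bases, which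
  tends to \<open>0\<close> because \<open>X\<close> is bounded.
\<close>

lemma expansion_of_orbit:
  assumes "orbit w X"
  shows "is_expansion m \<beta> w (X 0)"
proof -
  obtain q where q: "q > 1" "\<And>k. k \<le> m \<Longrightarrow> q \<le> \<beta> k" using greedy.uniform_expansion by blast
  have w: "\<And>i. w i \<le> m" using assms by (rule greedy.orbit_digit_le)
  have q_le: "q ^ n \<le> (\<Prod>j<n. \<beta> (w j))" for n
    using prod_mono[of "{..<n}" "\<lambda>_. q" "\<lambda>j. \<beta> (w j)"] q w by simp
  have pos: "(\<Prod>j<n. \<beta> (w j)) > 0" for n
    using q(1) by (intro less_le_trans[OF _ q_le]) simp
  have remainder: "X 0 - (\<Sum>i<n. weight w i) = X n / (\<Prod>j<n. \<beta> (w j))" for n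
  proof (induction n)
    case (Suc n)
    have "X (Suc n) = \<beta> (w n) * X n - real (w n)"
      using assms by (simp add: orbit_iff T_map_def)
    moreover have "\<beta> (w n) > 0" using base_gt_1[OF w, of n] by simp
    ultimately have "X n = (real (w n) + X (Suc n)) / \<beta> (w n)" by simp
    then have "X n / (\<Prod>j<n. \<beta> (w j)) =
        real (w n) / (\<Prod>j<Suc n. \<beta> (w j)) + X (Suc n) / (\<Prod>j<Suc n. \<beta> (w j))"
      by (simp add: add_divide_distrib mult.commute)
    with Suc show ?case by (simp add: lessThan_Suc_atMost[symmetric])
  qed simp
  have "(\<lambda>n. X 0 - (\<Sum>i<n. weight w i)) \<longlonglongrightarrow> 0"
  proof (rule tendsto_sandwich)
    show "\<forall>\<^sub>F n in sequentially. X 0 - (\<Sum>i<n. weight w i) \<le> top / q ^ n"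
      unfolding remainder using greedy.orbit_bounds[OF assms] q_le pos q(1) top_nonneg
      by (intro always_eventually allI frac_le) auto
    show "\<forall>\<^sub>F n in sequentially. 0 \<le> X 0 - (\<Sum>i<n. weight w i)"
      unfolding remainder using greedy.orbit_bounds[OF assms] pos
      by (intro always_eventually allI divide_nonneg_pos) auto
    show "(\<lambda>n. top / q ^ n) \<longlonglongrightarrow> 0" using q(1) by (rule LIMSEQ_divide_realpow_zero)
  qed simp
  from tendsto_diff[OF tendsto_const[of "X 0"] this] have "weight w sums X 0"
    by (simp add: sums_def)
  with w show ?thesis by (simp add: is_expansion_def)
qed

definition digit_partition :: "(nat \<Rightarrow> real set) \<Rightarrow> bool" where
  "digit_partition P \<longleftrightarrow> (\<forall>x\<in>{0..top}. \<exists>!k. k \<le> m \<and> x \<in> P k) \<and>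
     (\<forall>k\<le>m. P k \<subseteq> {a_pt \<beta> k..b_pt m \<beta> k})"

lemma piece_digit_eqI:
  assumes "digit_partition P" "x \<in> {0..top}" "k \<le> m" "x \<in> P k"
  shows "piece_digit m P x = k"
  using assms unfolding digit_partition_def piece_digit_def by (intro the1_equality) auto

lemma piece_digit_in:
  assumes "digit_partition P" "x \<in> {0..top}"
  shows "piece_digit m P x \<le> m" "x \<in> P (piece_digit m P x)"
proof -
  from assms have "\<exists>!k. k \<le> m \<and> x \<in> P k" by (simp add: digit_partition_def)
  from theI'[OF this] show "piece_digit m P x \<le> m" "x \<in> P (piece_digit m P x)"
    by (simp_all add: piece_digit_def)
qed

text \<open>
  The iterates stay in the interval because \<open>T\<^sub>k\<close> maps \<open>[a\<^sub>k, b\<^sub>k]\<close> onto \<open>[0, top]\<close>.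
\<close>

lemma piece_orbit:
  assumes P: "digit_partition P" and x: "x \<in> {0..top}"
  obtains X where "orbit (piece_expansion m \<beta> P x) X" "X 0 = x"
    "\<And>n. X n \<in> P (piece_expansion m \<beta> P x n)"
proof
  define X where "X n = (piece_map m \<beta> P ^^ n) x" for n
  show "X 0 = x" by (simp add: X_def)
  have digit: "piece_expansion m \<beta> P x n = piece_digit m P (X n)" for n
    by (simp add: piece_expansion_def X_def)
  have step: "X (Suc n) = T_map \<beta> (piece_digit m P (X n)) (X n)" for n
    by (simp add: X_def piece_map_def)
  have X: "X n \<in> {0..top}" for n
  proof (induction n)
    case (Suc n)
    let ?k = "piece_digit m P (X n)"
    have k: "?k \<le> m" and "X n \<in> P ?k" using piece_digit_in[OF P Suc] .
    with P have "X n \<in> {a_pt \<beta> ?k..b_pt m \<beta> ?k}" unfolding digit_partition_def by blast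
    then show ?case
      unfolding step
      using T_map_le_iff[OF k, of "a_pt \<beta> ?k" "X n"] T_map_le_iff[OF k, of "X n" "b_pt m \<beta> ?k"] T_map_ends[OF k]
      by simp
  qed (use x in \<open>simp add: X_def\<close>)
  show "X n \<in> P (piece_expansion m \<beta> P x n)" for n
    using piece_digit_in(2)[OF P X] by (simp add: digit)
  show "orbit (piece_expansion m \<beta> P x) X"
    using piece_digit_in(1)[OF P X] X by (simp add: orbit_iff digit step)
qed

lemma piece_expansion_iff:
  assumes P: "digit_partition P" and X: "orbit w X"
  shows "w = piece_expansion m \<beta> P (X 0) \<longleftrightarrow> (\<forall>n. X n \<in> P (w n))"
proof
  assume w: "w = piece_expansion m \<beta> P (X 0)"
  have "X 0 \<in> {0..top}" using X by (simp add: orbit_iff)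
  then obtain Y where Y: "orbit w Y" "Y 0 = X 0" "\<And>n. Y n \<in> P (w n)"
    using piece_orbit[OF P] w by metis
  have "Y n = X n" for n
    using Y(1,2) X by (induction n) (simp_all add: orbit_iff)
  with Y(3) show "\<forall>n. X n \<in> P (w n)" by simp
next
  assume *: "\<forall>n. X n \<in> P (w n)"
  have digit: "piece_digit m P (X n) = w n" for n
    using * X by (intro piece_digit_eqI[OF P]) (auto simp: orbit_iff)
  have "(piece_map m \<beta> P ^^ n) (X 0) = X n" for n
    using X by (induction n) (simp_all add: orbit_iff piece_map_def digit)
  then show "w = piece_expansion m \<beta> P (X 0)"
    by (simp add: fun_eq_iff piece_expansion_def digit)
qed

lemma digit_partitionI:
  assumes "\<And>x. x \<in> {0..top} \<Longrightarrow> Q m x"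
    and "\<And>x j k. j < k \<Longrightarrow> k < m \<Longrightarrow> Q j x \<Longrightarrow> Q k x"
    and "\<And>x k. x \<in> {0..top} \<Longrightarrow> k \<le> m \<Longrightarrow> x \<in> P k \<longleftrightarrow> Q k x \<and> (k = 0 \<or> \<not> Q (k - 1) x)"
    and "\<And>k. k \<le> m \<Longrightarrow> P k \<subseteq> {a_pt \<beta> k..b_pt m \<beta> k}"
  shows "digit_partition P"
proof -
  have "\<exists>!k. k \<le> m \<and> x \<in> P k" if x: "x \<in> {0..top}" for x
  proof -
    have "\<exists>!k. k \<le> m \<and> Q k x \<and> (k = 0 \<or> \<not> Q (k - 1) x)"
    proof (rule ex1_threshold)
      show "Q k x" if "j \<le> k" "k \<le> m" "Q j x" for j k
        using assms(1)[OF x] assms(2)[of j k x] that by (metis le_neq_implies_less)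
    qed (rule assms(1)[OF x])
    moreover have "k \<le> m \<and> x \<in> P k \<longleftrightarrow> k \<le> m \<and> Q k x \<and> (k = 0 \<or> \<not> Q (k - 1) x)" for k
      using assms(3)[OF x] by blast
    ultimately show ?thesis by simp
  qed
  with assms(4) show ?thesis by (simp add: digit_partition_def)
qed

lemma greedy_partition: "digit_partition (greedy_piece m \<beta>)"
proof (rule digit_partitionI[where Q = "\<lambda>k x. k = m \<or> x < a_pt \<beta> (Suc k)"])
  fix x j k assume "j < k" "k < m" "j = m \<or> x < a_pt \<beta> (Suc j)"
  then show "k = m \<or> x < a_pt \<beta> (Suc k)"
    using greedy.left_ends_mono[of "Suc j" "Suc k"] by auto
next
  fix x k assume "x \<in> {0..top}" "k \<le> m"
  then show "x \<in> greedy_piece m \<beta> k \<longleftrightarrow>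
      (k = m \<or> x < a_pt \<beta> (Suc k)) \<and> (k = 0 \<or> \<not> (k - 1 = m \<or> x < a_pt \<beta> (Suc (k - 1))))"
    using m_pos by (cases "k = 0") (auto simp: greedy_piece_def a_0 b_top)
next
  fix k assume "k \<le> m"
  then show "greedy_piece m \<beta> k \<subseteq> {a_pt \<beta> k..b_pt m \<beta> k}"
    using a_le_b[of k] by (auto simp: greedy_piece_def)
qed simp

lemma quasi_greedy_partition: "digit_partition (quasi_greedy_piece m \<beta>)"
proof (rule digit_partitionI[where Q = "\<lambda>k x. k = m \<or> x \<le> a_pt \<beta> (Suc k)"])
  fix x j k assume "j < k" "k < m" "j = m \<or> x \<le> a_pt \<beta> (Suc j)"
  then show "k = m \<or> x \<le> a_pt \<beta> (Suc k)"
    using greedy.left_ends_mono[of "Suc j" "Suc k"] by auto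
next
  fix x k assume "x \<in> {0..top}" "k \<le> m"
  then show "x \<in> quasi_greedy_piece m \<beta> k \<longleftrightarrow>
      (k = m \<or> x \<le> a_pt \<beta> (Suc k)) \<and> (k = 0 \<or> \<not> (k - 1 = m \<or> x \<le> a_pt \<beta> (Suc (k - 1))))"
    using m_pos by (cases "k = 0") (auto simp: quasi_greedy_piece_def b_top)
next
  fix k assume "k \<le> m"
  then show "quasi_greedy_piece m \<beta> k \<subseteq> {a_pt \<beta> k..b_pt m \<beta> k}"
    using a_le_b[of k] m_pos by (auto simp: quasi_greedy_piece_def a_0)
qed simp

lemma a_le_b_pred:
  assumes "0 < k" "k \<le> m"
  shows "a_pt \<beta> k \<le> b_pt m \<beta> (k - 1)"
  using a_le_b[of "k - 1"] assms by simp

lemma lazy_partition: "digit_partition (lazy_piece m \<beta>)"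
proof (rule digit_partitionI[where Q = "\<lambda>k x. x \<le> b_pt m \<beta> k"])
  fix x j k assume "j < k" "k < m" "x \<le> b_pt m \<beta> j"
  then show "x \<le> b_pt m \<beta> k" using b_mono[of j k] by auto
next
  fix x k assume "x \<in> {0..top}" "k \<le> m"
  then show "x \<in> lazy_piece m \<beta> k \<longleftrightarrow> x \<le> b_pt m \<beta> k \<and> (k = 0 \<or> \<not> x \<le> b_pt m \<beta> (k - 1))"
    by (auto simp: lazy_piece_def)
next
  fix k assume "k \<le> m"
  then show "lazy_piece m \<beta> k \<subseteq> {a_pt \<beta> k..b_pt m \<beta> k}"
    using a_le_b_pred[of k] by (auto simp: lazy_piece_def a_0)
qed (simp add: b_top)

lemma quasi_lazy_partition: "digit_partition (quasi_lazy_piece m \<beta>)"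
proof (rule digit_partitionI[where Q = "\<lambda>k x. k = m \<or> x < b_pt m \<beta> k"])
  fix x j k assume "j < k" "k < m" "j = m \<or> x < b_pt m \<beta> j"
  then show "k = m \<or> x < b_pt m \<beta> k" using b_mono[of j k] by auto
next
  fix x k assume "x \<in> {0..top}" "k \<le> m"
  then show "x \<in> quasi_lazy_piece m \<beta> k \<longleftrightarrow>
      (k = m \<or> x < b_pt m \<beta> k) \<and> (k = 0 \<or> \<not> (k - 1 = m \<or> x < b_pt m \<beta> (k - 1)))"
    using m_pos by (auto simp: quasi_lazy_piece_def b_top)
next
  fix k assume "k \<le> m"
  then show "quasi_lazy_piece m \<beta> k \<subseteq> {a_pt \<beta> k..b_pt m \<beta> k}"
    using a_le_b_pred[of k] m_pos by (auto simp: quasi_lazy_piece_def a_0)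
qed simp

text \<open>
  In an orbit the left end of the greedy piece and the right end of the lazy piece are respected
  automatically, which leaves one inequality per digit. It is stated after applying \<open>T\<^sub>k\<close>, as an
  inequality on the next point, to be compared with \<open>\<xi>\<^sub>\<plusminus>\<close> and \<open>\<eta>\<^sub>\<plusminus>\<close>.
\<close>

lemma greedy_exp_iff:
  assumes X: "orbit w X"
  shows "w = greedy_exp m \<beta> (X 0) \<longleftrightarrow>
    (\<forall>n. w n < m \<longrightarrow> X (Suc n) < T_map \<beta> (w n) (a_pt \<beta> (Suc (w n))))"
proof -
  have w: "w n \<le> m" and Suc: "X (Suc n) = T_map \<beta> (w n) (X n)" and X0: "0 \<le> X n" "X n \<le> top" for n
    using X by (simp_all add: orbit_iff)
  have "X n \<in> greedy_piece m \<beta> (w n) \<longleftrightarrow> (w n < m \<longrightarrow> X n < a_pt \<beta> (Suc (w n)))" for n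
    using w[of n] X0[of n] greedy.orbit_left_end_le[OF X, of n] by (auto simp: greedy_piece_def b_top)
  then show ?thesis
    unfolding greedy_exp_def piece_expansion_iff[OF greedy_partition X]
    by (simp add: Suc w T_map_less_iff)
qed

lemma orbit_le_right_end:
  assumes "orbit w X"
  shows "X n \<le> b_pt m \<beta> (w n)"
  using lazy.orbit_left_end_le[OF orbit_reflect[OF assms], of n] greedy.orbit_digit_le[OF assms, of n]
  by simp

lemma lazy_exp_iff:
  assumes X: "orbit w X"
  shows "w = lazy_exp m \<beta> (X 0) \<longleftrightarrow>
    (\<forall>n. w n > 0 \<longrightarrow> T_map \<beta> (w n) (b_pt m \<beta> (w n - 1)) < X (Suc n))"
proof -
  have w: "w n \<le> m" and Suc: "X (Suc n) = T_map \<beta> (w n) (X n)" and X0: "0 \<le> X n" for n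
    using X by (simp_all add: orbit_iff)
  have "X n \<in> lazy_piece m \<beta> (w n) \<longleftrightarrow> (w n > 0 \<longrightarrow> b_pt m \<beta> (w n - 1) < X n)" for n
    using X0[of n] orbit_le_right_end[OF X, of n] by (auto simp: lazy_piece_def)
  then show ?thesis
    unfolding lazy_exp_def piece_expansion_iff[OF lazy_partition X]
    by (simp add: Suc w T_map_less_iff)
qed

section \<open>Lexicographic criteria\<close>

lemma quasi_greedy_pieceD:
  assumes "x \<in> quasi_greedy_piece m \<beta> k"
  shows "k < m \<Longrightarrow> x \<le> a_pt \<beta> (Suc k)" "0 < k \<Longrightarrow> k \<le> m \<Longrightarrow> a_pt \<beta> k < x"
  using assms by (auto simp: quasi_greedy_piece_def split: if_splits)

lemma quasi_lazy_pieceD: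
  assumes "x \<in> quasi_lazy_piece m \<beta> k"
  shows "0 < k \<Longrightarrow> k \<le> m \<Longrightarrow> b_pt m \<beta> (k - 1) \<le> x" "k < m \<Longrightarrow> x < b_pt m \<beta> k"
  using assms by (auto simp: quasi_lazy_piece_def split: if_splits)

lemma quasi_greedy_orbit:
  assumes "\<xi> \<in> {0..top}"
  obtains Y where "orbit (quasi_greedy_exp m \<beta> \<xi>) Y" "Y 0 = \<xi>"
    "\<forall>n. quasi_greedy_exp m \<beta> \<xi> n < m \<longrightarrow> Y n \<le> a_pt \<beta> (Suc (quasi_greedy_exp m \<beta> \<xi> n))"
    "\<forall>n. quasi_greedy_exp m \<beta> \<xi> n > 0 \<longrightarrow> a_pt \<beta> (quasi_greedy_exp m \<beta> \<xi> n) < Y n"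
proof -
  let ?v = "quasi_greedy_exp m \<beta> \<xi>"
  obtain Y where Y: "orbit ?v Y" "Y 0 = \<xi>" "\<And>n. Y n \<in> quasi_greedy_piece m \<beta> (?v n)"
    using piece_orbit[OF quasi_greedy_partition assms] unfolding quasi_greedy_exp_def by blast
  show thesis
  proof (rule that[OF Y(1,2)])
    show "\<forall>n. ?v n < m \<longrightarrow> Y n \<le> a_pt \<beta> (Suc (?v n))"
      using quasi_greedy_pieceD(1)[OF Y(3)] by blast
    show "\<forall>n. ?v n > 0 \<longrightarrow> a_pt \<beta> (?v n) < Y n"
      using quasi_greedy_pieceD(2)[OF Y(3)] greedy.orbit_digit_le[OF Y(1)] by blast
  qed
qed

lemma quasi_lazy_orbit:
  assumes "\<eta> \<in> {0..top}"
  obtains Y where "orbit (quasi_lazy_exp m \<beta> \<eta>) Y" "Y 0 = \<eta>"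
    "\<forall>n. quasi_lazy_exp m \<beta> \<eta> n > 0 \<longrightarrow> b_pt m \<beta> (quasi_lazy_exp m \<beta> \<eta> n - 1) \<le> Y n"
    "\<forall>n. quasi_lazy_exp m \<beta> \<eta> n < m \<longrightarrow> Y n < b_pt m \<beta> (quasi_lazy_exp m \<beta> \<eta> n)"
proof -
  let ?v = "quasi_lazy_exp m \<beta> \<eta>"
  obtain Y where Y: "orbit ?v Y" "Y 0 = \<eta>" "\<And>n. Y n \<in> quasi_lazy_piece m \<beta> (?v n)"
    using piece_orbit[OF quasi_lazy_partition assms] unfolding quasi_lazy_exp_def by blast
  show thesis
  proof (rule that[OF Y(1,2)])
    show "\<forall>n. ?v n > 0 \<longrightarrow> b_pt m \<beta> (?v n - 1) \<le> Y n"
      using quasi_lazy_pieceD(1)[OF Y(3)] greedy.orbit_digit_le[OF Y(1)] by blast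
    show "\<forall>n. ?v n < m \<longrightarrow> Y n < b_pt m \<beta> (?v n)"
      using quasi_lazy_pieceD(2)[OF Y(3)] by blast
  qed
qed

lemma T_map_Suc_a_bounds:
  assumes "k < m"
  shows "T_map \<beta> k (a_pt \<beta> (Suc k)) \<in> {0..top}"
  using T_map_le_iff[of k "a_pt \<beta> k" "a_pt \<beta> (Suc k)"] T_map_le_iff[of k "a_pt \<beta> (Suc k)" "b_pt m \<beta> k"]
    T_map_ends[of k] a_less[OF assms] a_le_b[OF assms] assms by simp

lemma T_map_pred_b_bounds:
  assumes "0 < k" "k \<le> m"
  shows "T_map \<beta> k (b_pt m \<beta> (k - 1)) \<in> {0..top}"
  using T_map_le_iff[of k "a_pt \<beta> k" "b_pt m \<beta> (k - 1)"]
    T_map_le_iff[of k "b_pt m \<beta> (k - 1)" "b_pt m \<beta> k"]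
    T_map_ends[of k] a_le_b_pred[OF assms] b_mono[of "k - 1" k] assms by simp

lemma xi_bounds:
  assumes "k < m"
  shows "xi_minus m \<beta> \<le> T_map \<beta> k (a_pt \<beta> (Suc k))" "T_map \<beta> k (a_pt \<beta> (Suc k)) \<le> xi_plus m \<beta>"
  using assms by (auto simp: xi_minus_def xi_plus_def intro!: Min_le Max_ge imageI)

lemma xi_in:
  shows "xi_minus m \<beta> \<in> {0..top}" "xi_plus m \<beta> \<in> {0..top}"
proof -
  let ?C = "(\<lambda>k. T_map \<beta> k (a_pt \<beta> (k + 1))) ` {0..m - 1}"
  have "?C \<subseteq> {0..top}" using T_map_Suc_a_bounds m_pos by force
  moreover have "Min ?C \<in> ?C" "Max ?C \<in> ?C" by (intro Min_in Max_in; simp)+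
  ultimately show "xi_minus m \<beta> \<in> {0..top}" "xi_plus m \<beta> \<in> {0..top}"
    unfolding xi_minus_def xi_plus_def by blast+
qed

lemma eta_bounds:
  assumes "0 < k" "k \<le> m"
  shows "eta_minus m \<beta> \<le> T_map \<beta> k (b_pt m \<beta> (k - 1))" "T_map \<beta> k (b_pt m \<beta> (k - 1)) \<le> eta_plus m \<beta>"
  using assms by (auto simp: eta_minus_def eta_plus_def intro!: Min_le Max_ge imageI)

lemma eta_in:
  shows "eta_minus m \<beta> \<in> {0..top}" "eta_plus m \<beta> \<in> {0..top}"
proof -
  let ?C = "(\<lambda>k. T_map \<beta> k (b_pt m \<beta> (k - 1))) ` {1..m}"
  have "?C \<subseteq> {0..top}" using T_map_pred_b_bounds by force
  moreover have "Min ?C \<in> ?C" "Max ?C \<in> ?C" using m_pos by (intro Min_in Max_in; simp)+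
  ultimately show "eta_minus m \<beta> \<in> {0..top}" "eta_plus m \<beta> \<in> {0..top}"
    unfolding eta_minus_def eta_plus_def by blast+
qed

lemma greedy_necessary:
  assumes w: "is_expansion m \<beta> w x" "w = greedy_exp m \<beta> x" and n: "w n < m"
  shows "less_fun (\<lambda>i. w (i + Suc n)) (quasi_greedy_exp m \<beta> (xi_plus m \<beta>))"
proof -
  let ?v = "quasi_greedy_exp m \<beta> (xi_plus m \<beta>)"
  obtain X where X: "orbit w X" "X 0 = x" using orbit_of_expansion[OF w(1)] by blast
  obtain Y where Y: "orbit ?v Y" "Y 0 = xi_plus m \<beta>"
    "\<forall>n. ?v n < m \<longrightarrow> Y n \<le> a_pt \<beta> (Suc (?v n))" "\<forall>n. ?v n > 0 \<longrightarrow> a_pt \<beta> (?v n) < Y n"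
    using quasi_greedy_orbit[OF xi_in(2)] by blast
  have "X (Suc n) < T_map \<beta> (w n) (a_pt \<beta> (Suc (w n)))"
    using greedy_exp_iff[OF X(1)] X(2) w(2) n by blast
  also have "\<dots> \<le> xi_plus m \<beta>" using n by (rule xi_bounds)
  finally show ?thesis
    using greedy.less_quasi_greedy_if_less[OF greedy.orbit_shift[OF X(1), of "Suc n"] Y(1) Y(3)[rule_format]] Y(2)
    by simp
qed

lemma greedy_sufficient:
  assumes w: "is_expansion m \<beta> w x"
    and lex: "\<And>n. w n < m \<Longrightarrow> less_fun (\<lambda>i. w (i + Suc n)) (quasi_greedy_exp m \<beta> (xi_minus m \<beta>))"
  shows "w = greedy_exp m \<beta> x"
proof -
  let ?v = "quasi_greedy_exp m \<beta> (xi_minus m \<beta>)"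
  obtain X where X: "orbit w X" "X 0 = x" using orbit_of_expansion[OF w] by blast
  obtain Y where Y: "orbit ?v Y" "Y 0 = xi_minus m \<beta>"
    "\<forall>n. ?v n < m \<longrightarrow> Y n \<le> a_pt \<beta> (Suc (?v n))" "\<forall>n. ?v n > 0 \<longrightarrow> a_pt \<beta> (?v n) < Y n"
    using quasi_greedy_orbit[OF xi_in(1)] by blast
  have start: "Y 0 \<le> greedy.branch k (a_pt \<beta> (Suc k))" if "k < m" for k
    using xi_bounds(1)[OF that] that Y(2) by (simp add: greedy_branch)
  have "X (Suc n) < xi_minus m \<beta>" if "w n < m" for n
    using greedy.parry_criterion[OF X(1) Y(1) Y(4)[rule_format] start lex that] Y(2) by simp
  then show ?thesis
    using greedy_exp_iff[OF X(1)] X(2) xi_bounds(1) by (meson less_le_trans)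
qed

lemma lazy_necessary:
  assumes w: "is_expansion m \<beta> w x" "w = lazy_exp m \<beta> x" and n: "w n > 0"
  shows "less_fun (quasi_lazy_exp m \<beta> (eta_minus m \<beta>)) (\<lambda>i. w (i + Suc n))"
proof -
  let ?v = "quasi_lazy_exp m \<beta> (eta_minus m \<beta>)"
  obtain X where X: "orbit w X" "X 0 = x" using orbit_of_expansion[OF w(1)] by blast
  obtain Y where Y: "orbit ?v Y" "Y 0 = eta_minus m \<beta>"
    "\<forall>n. ?v n > 0 \<longrightarrow> b_pt m \<beta> (?v n - 1) \<le> Y n" "\<forall>n. ?v n < m \<longrightarrow> Y n < b_pt m \<beta> (?v n)"
    using quasi_lazy_orbit[OF eta_in(1)] by blast
  have w_le: "w n \<le> m" and v_le: "?v n \<le> m" for n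
    using X(1) Y(1) by (auto simp: orbit_iff)
  have "Y 0 \<le> T_map \<beta> (w n) (b_pt m \<beta> (w n - 1))" using n w_le Y(2) eta_bounds(1) by simp
  also have "\<dots> < X (Suc n)" using lazy_exp_iff[OF X(1)] X(2) w(2) n by blast
  finally have less: "- X (Suc n) < - Y 0" by simp
  have quasi_lazy: "- Y i \<le> - b_pt m \<beta> (m - Suc (m - ?v i))" if "m - ?v i < m" for i
  proof -
    have "m - Suc (m - ?v i) = ?v i - 1" using v_le[of i] that by simp
    with Y(3)[rule_format, of i] that show ?thesis by simp
  qed
  have "less_fun (\<lambda>i. m - w (i + Suc n)) (\<lambda>i. m - ?v i)"
    using lazy.less_quasi_greedy_if_less[OF orbit_reflect[OF greedy.orbit_shift[OF X(1), of "Suc n"]]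
        orbit_reflect[OF Y(1)] quasi_lazy] less by simp
  then show ?thesis using w_le v_le by (rule less_fun_reflect)
qed

lemma lazy_sufficient:
  assumes w: "is_expansion m \<beta> w x"
    and lex: "\<And>n. w n > 0 \<Longrightarrow> less_fun (quasi_lazy_exp m \<beta> (eta_plus m \<beta>)) (\<lambda>i. w (i + Suc n))"
  shows "w = lazy_exp m \<beta> x"
proof -
  let ?v = "quasi_lazy_exp m \<beta> (eta_plus m \<beta>)"
  obtain X where X: "orbit w X" "X 0 = x" using orbit_of_expansion[OF w] by blast
  obtain Y where Y: "orbit ?v Y" "Y 0 = eta_plus m \<beta>"
    "\<forall>n. ?v n > 0 \<longrightarrow> b_pt m \<beta> (?v n - 1) \<le> Y n" "\<forall>n. ?v n < m \<longrightarrow> Y n < b_pt m \<beta> (?v n)"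
    using quasi_lazy_orbit[OF eta_in(2)] by blast
  have w_le: "w n \<le> m" and v_le: "?v n \<le> m" for n
    using X(1) Y(1) by (auto simp: orbit_iff)
  have quasi_lazy: "- b_pt m \<beta> (m - (m - ?v i)) < - Y i" if "m - ?v i > 0" for i
    using Y(4)[rule_format, of i] that by simp
  have start: "- Y 0 \<le> lazy.branch k (- b_pt m \<beta> (m - Suc k))" if "k < m" for k
    using eta_bounds(2)[of "m - k"] that Y(2) by (simp add: lazy_branch)
  have lex': "less_fun (\<lambda>i. m - w (i + Suc n)) (\<lambda>i. m - ?v i)" if "m - w n < m" for n
    using lex[of n] that w_le v_le by (intro less_fun_reflectI) auto
  have "eta_plus m \<beta> < X (Suc n)" if "w n > 0" for n
  proof -
    have "m - w n < m" using that m_pos by simp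
    from lazy.parry_criterion[OF orbit_reflect[OF X(1)] orbit_reflect[OF Y(1)] quasi_lazy start lex' this]
    show ?thesis using Y(2) by simp
  qed
  then show ?thesis
    using lazy_exp_iff[OF X(1)] X(2) eta_bounds(2) w_le by (meson le_less_trans)
qed

text \<open>
  Two expansions of the same point reach a common point at their first difference. There the
  greedy digit is the largest possible and the lazy digit the smallest possible, so an expansion
  that is both admits no competitor. Conversely, the greedy and the lazy expansion are expansions,
  so a unique expansion coincides with both.
\<close>

lemma unique_iff_greedy_and_lazy:
  assumes w: "is_expansion m \<beta> w x"
  shows "is_unique_expansion m \<beta> w x \<longleftrightarrow> w = greedy_exp m \<beta> x \<and> w = lazy_exp m \<beta> x"
proof
  assume u: "is_unique_expansion m \<beta> w x"
  have x: "x \<in> {0..top}" using is_expansion_bounds[OF w] by simp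
  have "is_expansion m \<beta> (piece_expansion m \<beta> P x) x" if "digit_partition P" for P
    using piece_orbit[OF that x] expansion_of_orbit by metis
  with u show "w = greedy_exp m \<beta> x \<and> w = lazy_exp m \<beta> x"
    unfolding is_unique_expansion_def greedy_exp_def lazy_exp_def
    using greedy_partition lazy_partition by metis
next
  assume gl: "w = greedy_exp m \<beta> x \<and> w = lazy_exp m \<beta> x"
  obtain X where X: "orbit w X" "X 0 = x" using orbit_of_expansion[OF w] by blast
  have w_le: "w n \<le> m" for n using X(1) by (simp add: orbit_iff)
  have Suc: "X (Suc n) = T_map \<beta> (w n) (X n)" for n using X(1) by (simp add: orbit_iff)
  have g: "X n < a_pt \<beta> (Suc (w n))" if "w n < m" for n
  proof -
    have "X (Suc n) < T_map \<beta> (w n) (a_pt \<beta> (Suc (w n)))"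
      using greedy_exp_iff[OF X(1)] gl X(2) that by blast
    then show ?thesis using w_le[of n] by (simp add: Suc T_map_less_iff)
  qed
  have l: "b_pt m \<beta> (w n - 1) < X n" if "w n > 0" for n
  proof -
    have "T_map \<beta> (w n) (b_pt m \<beta> (w n - 1)) < X (Suc n)"
      using lazy_exp_iff[OF X(1)] gl X(2) that by blast
    then show ?thesis using w_le[of n] by (simp add: Suc T_map_less_iff)
  qed
  have "v = w" if v: "is_expansion m \<beta> v x" for v
  proof -
    obtain Z where Z: "orbit v Z" "Z 0 = x" using orbit_of_expansion[OF v] by blast
    have v_le: "v n \<le> m" for n using Z(1) by (simp add: orbit_iff)
    have digit: "v n = w n" if eq: "Z n = X n" for n
    proof (rule antisym)
      show "v n \<le> w n"
        using greedy.digit_le_greedy_digit[OF Z(1) v_le] g eq by simp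
      have "- Z n < - b_pt m \<beta> (m - Suc (m - w n))" if "m - w n < m"
      proof -
        have "m - Suc (m - w n) = w n - 1" using w_le[of n] that by simp
        with l[of n] that eq show ?thesis by simp
      qed
      then have "m - v n \<le> m - w n"
        by (rule lazy.digit_le_greedy_digit[OF orbit_reflect[OF Z(1)] diff_le_self])
      then show "w n \<le> v n" using w_le[of n] v_le[of n] by linarith
    qed
    have "Z n = X n" for n
    proof (induction n)
      case (Suc n)
      with digit[OF Suc] show ?case using X(1) Z(1) by (simp add: orbit_iff)
    qed (simp add: X(2) Z(2))
    with digit show "v = w" by auto
  qed
  with w show "is_unique_expansion m \<beta> w x" unfolding is_unique_expansion_def by blast
qed

end

lemma seq_shift_power: "(seq_shift ^^ n) w = (\<lambda>i. w (i + n))"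
  by (induction n) (simp_all add: seq_shift_def)

theorem theorem1p3:
  fixes m :: nat and \<beta> :: "nat \<Rightarrow> real" and x :: real and w :: "nat \<Rightarrow> nat"
  assumes "m \<ge> 1"
    and "\<beta> \<in> D_set m"
    and "x \<in> {0..real m / (\<beta> m - 1)}"
    and "is_expansion m \<beta> w x"
  shows
    "(w = greedy_exp m \<beta> x \<longrightarrow>
        (\<forall>n\<ge>1. w (n - 1) < m \<longrightarrow>
           less_fun ((seq_shift ^^ n) w) (quasi_greedy_exp m \<beta> (xi_plus m \<beta>))))
   \<and> ((\<forall>n\<ge>1. w (n - 1) < m \<longrightarrow>
           less_fun ((seq_shift ^^ n) w) (quasi_greedy_exp m \<beta> (xi_minus m \<beta>)))
        \<longrightarrow> w = greedy_exp m \<beta> x)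
   \<and> (w = lazy_exp m \<beta> x \<longrightarrow>
        (\<forall>n\<ge>1. w (n - 1) > 0 \<longrightarrow>
           less_fun (quasi_lazy_exp m \<beta> (eta_minus m \<beta>)) ((seq_shift ^^ n) w)))
   \<and> ((\<forall>n\<ge>1. w (n - 1) > 0 \<longrightarrow>
           less_fun (quasi_lazy_exp m \<beta> (eta_plus m \<beta>)) ((seq_shift ^^ n) w))
        \<longrightarrow> w = lazy_exp m \<beta> x)
   \<and> (is_unique_expansion m \<beta> w x \<longrightarrow>
        (\<forall>n\<ge>1. w (n - 1) < m \<longrightarrow>
           less_fun ((seq_shift ^^ n) w) (quasi_greedy_exp m \<beta> (xi_plus m \<beta>)))
        \<and> (\<forall>n\<ge>1. w (n - 1) > 0 \<longrightarrow>
           less_fun (quasi_lazy_exp m \<beta> (eta_minus m \<beta>)) ((seq_shift ^^ n) w)))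
   \<and> ((\<forall>n\<ge>1. w (n - 1) < m \<longrightarrow>
           less_fun ((seq_shift ^^ n) w) (quasi_greedy_exp m \<beta> (xi_minus m \<beta>)))
        \<and> (\<forall>n\<ge>1. w (n - 1) > 0 \<longrightarrow>
           less_fun (quasi_lazy_exp m \<beta> (eta_plus m \<beta>)) ((seq_shift ^^ n) w))
        \<longrightarrow> is_unique_expansion m \<beta> w x)"
proof -
  interpret multiple_bases m \<beta> using assms(1,2) by unfold_locales
  have reindex: "(\<forall>n\<ge>1. P (w (n - 1)) \<longrightarrow> R ((seq_shift ^^ n) w)) \<longleftrightarrow>
      (\<forall>n. P (w n) \<longrightarrow> R (\<lambda>i. w (i + Suc n)))" for P R
    unfolding seq_shift_power by (metis One_nat_def Suc_le_D diff_Suc_1 le_add1 plus_1_eq_Suc)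
  \<comment> \<open>Naming the two families of conditions reduces the claim to propositional logic.\<close>
  define below where "below \<xi> \<longleftrightarrow> (\<forall>n\<ge>1. w (n - 1) < m \<longrightarrow>
      less_fun ((seq_shift ^^ n) w) (quasi_greedy_exp m \<beta> \<xi>))" for \<xi>
  define above where "above \<eta> \<longleftrightarrow> (\<forall>n\<ge>1. w (n - 1) > 0 \<longrightarrow>
      less_fun (quasi_lazy_exp m \<beta> \<eta>) ((seq_shift ^^ n) w))" for \<eta>
  have below_iff: "below \<xi> \<longleftrightarrow>
      (\<forall>n. w n < m \<longrightarrow> less_fun (\<lambda>i. w (i + Suc n)) (quasi_greedy_exp m \<beta> \<xi>))" for \<xi>
    unfolding below_def by (rule reindex)
  have above_iff: "above \<eta> \<longleftrightarrow>
      (\<forall>n. w n > 0 \<longrightarrow> less_fun (quasi_lazy_exp m \<beta> \<eta>) (\<lambda>i. w (i + Suc n)))" for \<eta>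
    unfolding above_def by (rule reindex)
  have "w = greedy_exp m \<beta> x \<Longrightarrow> below (xi_plus m \<beta>)"
    unfolding below_iff using greedy_necessary[OF assms(4)] by blast
  moreover have "below (xi_minus m \<beta>) \<Longrightarrow> w = greedy_exp m \<beta> x"
    unfolding below_iff by (rule greedy_sufficient[OF assms(4)]) simp
  moreover have "w = lazy_exp m \<beta> x \<Longrightarrow> above (eta_minus m \<beta>)"
    unfolding above_iff using lazy_necessary[OF assms(4)] by blast
  moreover have "above (eta_plus m \<beta>) \<Longrightarrow> w = lazy_exp m \<beta> x"
    unfolding above_iff by (rule lazy_sufficient[OF assms(4)]) simp
  ultimately show ?thesis
    unfolding below_def[symmetric] above_def[symmetric] unique_iff_greedy_and_lazy[OF assms(4)]
    by blast
qed

end
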